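(* Suppose that $X$ is any real Banach space of dimension bigger than $1$ belonging to one of the following classes: (1) $X$ admits a fundamental biorthogonal system; (2) $X$ has density $\omega_n$ for some $n\in\mathbb{N}$. Then each subset of $X$ of cardinality smaller than $\operatorname{cf}([\operatorname{dens}(X)]^\omega)$ can be covered by countably many hyperplanes, i.e., $\mathfrak{non}(X)=\operatorname{cf}([\operatorname{dens}(X)]^\omega)$.
   Context: A hyperplane of a Banach space $X$ is a one-codimensional closed linear subspace of $X$. $\mathfrak{non}(X)$ is the minimal cardinality of a subset of $X$ that cannot be covered by countably many hyperplanes of $X$. $\operatorname{dens}(X)$ (the density of $X$) is the minimal cardinality of a norm-dense subset of $X$. For a cardinal $\kappa$, $[\kappa]^\omega$ is the set of countable subsets of $\kappa$, and $\operatorname{cf}([\kappa]^\omega)$ is the minimal cardinality of a family of countable subsets of $\kappa$ such that every countable subset of $\kappa$ is included in an element of the family. $X^*$ is the space of bounded linear functionals on $X$. A biorthogonal system in $X$ is a family $(x_i,x_i^* )_{i\in I}$ with $x_i\in X$, $x_i^*\in X^*$ and $x_i^*(x_j)=\delta_{i,j}$; it is fundamental if the closed linear span of $\{x_i:i\in I\}$ is $X$. $\mathbb{N}$ is the set of non-negative integers, and $\omega_n$ is the $n$-th infinite cardinal (with $\omega_0=\omega$).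
   Formalization: The equality non(X) = cf([dens(X)]^ω) is stated only for nonseparable X: for separable X of dimension > 1 it is false, since cf([ω]^ω) = 1 while every countable set is covered by countably many hyperplanes. The covering claim is stated for all X. *)

theory Defs
  imports "HOL-Analysis.Analysis"
begin

no_notation Set_Algebras.elt_set_eq (infix \<open>=o\<close> 50)
unbundle cardinal_syntax

text \<open>Cardinals are represented, as in the library, by cardinal orders; equality and comparison of
  cardinals are \<open>=o\<close>, \<open><o\<close> and \<open>\<le>o\<close>, which compare cardinals living on different types.\<close>

text \<open>The minimal cardinality of a set with property \<open>P\<close>; unspecified if there is no such set.\<close>

definition min_card :: "('a set \<Rightarrow> bool) \<Rightarrow> 'a rel" where
  "min_card P = |SOME A. P A \<and> (\<forall>B. P B \<longrightarrow> |A| \<le>o |B| )|"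

lemma min_card_attained:
  assumes "\<exists>A. P A"
  shows "\<exists>A. P A \<and> (\<forall>B. P B \<longrightarrow> |A| \<le>o |B| ) \<and> min_card P = |A|"
proof -
  have "\<exists>r \<in> card_of ` Collect P. \<forall>r' \<in> card_of ` Collect P. r \<le>o r'"
    using assms by (intro exists_minim_Card_order) (auto simp: card_of_Card_order)
  then have "\<exists>A. P A \<and> (\<forall>B. P B \<longrightarrow> |A| \<le>o |B| )"
    by auto
  from someI_ex[OF this] show ?thesis
    unfolding min_card_def by blast
qed

definition hyperplane :: "'a::real_normed_vector set \<Rightarrow> bool" where
  "hyperplane H \<longleftrightarrow> closed H \<and> subspace H \<and> (\<exists>v. v \<notin> H \<and> span (insert v H) = UNIV)"

definition countably_hyperplane_covered :: "'a::real_normed_vector set \<Rightarrow> bool" where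
  "countably_hyperplane_covered A \<longleftrightarrow>
     (\<exists>\<H>. countable \<H> \<and> (\<forall>H\<in>\<H>. hyperplane H) \<and> A \<subseteq> \<Union>\<H>)"

definition non :: "'a::real_normed_vector itself \<Rightarrow> 'a rel" where
  "non T = min_card (\<lambda>A. \<not> countably_hyperplane_covered A)"

definition dens :: "'a::real_normed_vector itself \<Rightarrow> 'a rel" where
  "dens T = min_card (\<lambda>D. closure D = UNIV)"

text \<open>The cofinality of \<open>[\<kappa>]\<^sup>\<omega>\<close>, where the order \<open>\<kappa>\<close> stands for its
  underlying set \<open>Field \<kappa>\<close>; ``countable'' includes ``finite''.\<close>

definition cf_countable_subsets :: "'a rel \<Rightarrow> 'a set rel" where
  "cf_countable_subsets \<kappa> = min_card (\<lambda>\<F>.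
     (\<forall>C\<in>\<F>. C \<subseteq> Field \<kappa> \<and> countable C) \<and>
     (\<forall>B. B \<subseteq> Field \<kappa> \<and> countable B \<longrightarrow> (\<exists>C\<in>\<F>. B \<subseteq> C)))"

definition biorthogonal_system ::
  "'i set \<Rightarrow> ('i \<Rightarrow> 'a::real_normed_vector) \<Rightarrow> ('i \<Rightarrow> 'a \<Rightarrow>\<^sub>L real) \<Rightarrow> bool" where
  "biorthogonal_system I x f \<longleftrightarrow>
     (\<forall>i\<in>I. \<forall>j\<in>I. blinfun_apply (f i) (x j) = (if i = j then 1 else 0))"

definition fundamental_biorthogonal_system ::
  "'i set \<Rightarrow> ('i \<Rightarrow> 'a::real_normed_vector) \<Rightarrow> ('i \<Rightarrow> 'a \<Rightarrow>\<^sub>L real) \<Rightarrow> bool" where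
  "fundamental_biorthogonal_system I x f \<longleftrightarrow>
     biorthogonal_system I x f \<and> closure (span (x ` I)) = UNIV"

text \<open>\<open>is_omega n r\<close>: the cardinal \<open>r\<close> is \<open>\<omega>\<^sub>n\<close>. A predicate is used because
  \<open>cardSuc\<close> raises the type, so that it cannot be iterated. Restricting \<open>s\<close> to the type of
  \<open>r\<close> is harmless, since every cardinal below \<open>r\<close> has a copy on that type.\<close>

primrec is_omega :: "nat \<Rightarrow> 'a rel \<Rightarrow> bool" where
  "is_omega 0 r \<longleftrightarrow> r =o natLeq"
| "is_omega (Suc n) r \<longleftrightarrow> (\<exists>s :: 'a rel. is_omega n s \<and> r =o cardSuc s)"

end

theory Submission
  imports Defs "HOL-Complex_Analysis.Conformal_Mappings" "HOL-Library.Countable_Set_Type"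
begin

no_notation Set_Algebras.elt_set_eq (infix \<open>=o\<close> 50)

text \<open>Write \<open>\<kappa>\<close> for the density of the space and \<open>cf\<close> for the cofinality of
  \<open>[\<kappa>]\<^sup>\<omega>\<close>. If \<open>\<kappa>\<close> is countable, a single set is cofinal, so only the empty set has
  fewer than \<open>cf\<close> elements. Let \<open>\<kappa>\<close> be uncountable.

  Small sets are covered for two different reasons. Given a fundamental biorthogonal system
  \<open>(x\<^sub>i, f\<^sub>i)\<close>, every vector \<open>a\<close> has a countable support, the set of all \<open>i\<close> with
  \<open>f\<^sub>i(a) \<noteq> 0\<close>, being a limit of a sequence of finite combinations of the \<open>x\<^sub>i\<close>. There are at
  least \<open>\<kappa>\<close> indices, so fewer than \<open>cf\<close> supports cannot be cofinal: some countable set \<open>B\<close> of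
  indices lies in no support. This says that the kernels of the \<open>f\<^sub>i\<close> with \<open>i \<in> B\<close> cover
  (\<open>covered_if_fundamental_biorthogonal_system\<close>). If \<open>\<kappa> = \<omega>\<^sub>n\<close>, then \<open>cf\<close> is at most
  \<open>\<kappa>\<close>, by induction on \<open>n\<close> and the regularity of successor cardinals
  (\<open>cofinal_family_omega\<close>). A set of fewer than \<open>\<kappa>\<close> vectors does not span a dense subspace,
  so by the Hahn-Banach theorem one hyperplane contains it (\<open>covered_if_card_less_dens\<close>).

  For the converse bound in \<open>non X\<close> (\<open>exists_uncovered_set_of_card_cf\<close>) take a dense set \<open>D\<close>
  of size \<open>\<kappa>\<close> and a cofinal family of \<open>cf\<close> countable subsets of \<open>D\<close>. Attach to each member
  \<open>C = {c\<^sub>0, c\<^sub>1, \<dots>}\<close> uncountably many, but at most \<open>cf\<close>, points of the curve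
  \<open>t \<mapsto> \<Sum>n. t\<^sup>n c\<^sub>n\<close>, with the \<open>c\<^sub>n\<close> normalized. A functional that does not vanish on
  \<open>C\<close> turns the curve into a nonzero power series, which has only countably many zeros. Given
  countably many hyperplanes, some \<open>C\<close> contains a point outside each of them, so they
  contain only countably many of the points attached to \<open>C\<close>.\<close>

section \<open>Hyperplanes and bounded functionals\<close>

text \<open>The Hahn-Banach extension step, with functionals represented by their graphs. For a subspace
  \<open>G\<close> of the product, domination by the norm already makes \<open>G\<close> single-valued: both
  \<open>(0, r)\<close> and \<open>(0, -r)\<close> lie in \<open>G\<close> as soon as one does. Zorn's lemma therefore needs no
  separate bookkeeping of domains.\<close>

lemma dominated_graph_extends_total:
  fixes G0 :: "('a::real_normed_vector \<times> real) set"
  assumes "subspace G0" "\<And>x r. (x, r) \<in> G0 \<Longrightarrow> r \<le> norm x"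
  obtains G where "subspace G" "G0 \<subseteq> G" "\<And>x r. (x, r) \<in> G \<Longrightarrow> r \<le> norm x"
    "\<And>x. \<exists>r. (x, r) \<in> G"
proof -
  define \<A> where "\<A> = {G. subspace G \<and> G0 \<subseteq> G \<and> (\<forall>(x, r)\<in>G. r \<le> norm x)}"
  have "\<exists>G\<in>\<A>. \<forall>G'\<in>\<A>. G \<subseteq> G' \<longrightarrow> G' = G"
  proof (rule subset_Zorn_nonempty)
    show "\<A> \<noteq> {}" using assms unfolding \<A>_def by auto
    fix \<C> assume ne: "\<C> \<noteq> {}" and "subset.chain \<A> \<C>"
    then have sub: "\<C> \<subseteq> \<A>" and chain: "\<And>A B. A \<in> \<C> \<Longrightarrow> B \<in> \<C> \<Longrightarrow> A \<subseteq> B \<or> B \<subseteq> A"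
      unfolding subset.chain_def by blast+
    have subspaces: "subspace A" if "A \<in> \<C>" for A using that sub unfolding \<A>_def by blast
    have "subspace (\<Union>\<C>)"
      unfolding subspace_def
    proof (intro conjI ballI allI)
      show "0 \<in> \<Union>\<C>" using ne subspaces subspace_0 by blast
      show "x + y \<in> \<Union>\<C>" if xy: "x \<in> \<Union>\<C>" "y \<in> \<Union>\<C>" for x y
      proof -
        obtain A B where AB: "A \<in> \<C>" "B \<in> \<C>" "x \<in> A" "y \<in> B" using xy by blast
        then consider "x \<in> B" | "y \<in> A" using chain[OF AB(1,2)] by blast
        then show ?thesis
          by cases (use AB subspaces subspace_add in blast)+
      qed
      show "c *\<^sub>R x \<in> \<Union>\<C>" if "x \<in> \<Union>\<C>" for c x
        using that subspaces subspace_scale by blast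
    qed
    then show "\<Union>\<C> \<in> \<A>" using ne sub unfolding \<A>_def by blast
  qed
  then obtain G where G: "G \<in> \<A>" and max: "\<And>G'. G' \<in> \<A> \<Longrightarrow> G \<subseteq> G' \<Longrightarrow> G' = G" by blast
  then have sG: "subspace G" and G0: "G0 \<subseteq> G" and dom: "\<And>x r. (x, r) \<in> G \<Longrightarrow> r \<le> norm x"
    unfolding \<A>_def by auto
  have "\<exists>r. (y, r) \<in> G" for y
  proof -
    \<comment> \<open>The value at \<open>y\<close> must lie between all lower bounds \<open>r - norm (x - y)\<close> and all upper
      bounds \<open>norm (x + y) - r\<close>; the supremum of the lower bounds is such a value.\<close>
    define L where "L = (\<lambda>(x, r). r - norm (x - y)) ` G"
    have between: "r - norm (x - y) \<le> norm (x' + y) - r'" if "(x, r) \<in> G" "(x', r') \<in> G" for x r x' r'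
    proof -
      have "(x + x', r + r') \<in> G" using subspace_add[OF sG that] by simp
      from dom[OF this] have "r + r' \<le> norm ((x - y) + (x' + y))" by simp
      also have "\<dots> \<le> norm (x - y) + norm (x' + y)" by (rule norm_triangle_ineq)
      finally show ?thesis by simp
    qed
    have zero: "(0, 0) \<in> G" using subspace_0[OF sG] by (simp add: zero_prod_def)
    have "bdd_above L" unfolding L_def using between[OF _ zero] by (intro bdd_aboveI) auto
    then have lower: "r - norm (x - y) \<le> Sup L" if "(x, r) \<in> G" for x r
      using that unfolding L_def by (intro cSup_upper) auto
    have upper: "Sup L \<le> norm (x + y) - r" if "(x, r) \<in> G" for x r
      unfolding L_def using zero between[OF _ that] by (intro cSup_least) auto
    define G' where "G' = span (insert (y, Sup L) G)"
    have "r \<le> norm x" if "(x, r) \<in> G'" for x r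
    proof -
      from that obtain k where "(x, r) - k *\<^sub>R (y, Sup L) \<in> span G"
        unfolding G'_def span_breakdown_eq by blast
      then have k: "(x - k *\<^sub>R y, r - k * Sup L) \<in> G" unfolding span_eq_iff[THEN iffD2, OF sG] by simp
      consider "k = 0" | "k > 0" | "k < 0" by linarith
      then show ?thesis
      proof cases
        case 1
        then show ?thesis using dom[OF k] by simp
      next
        case 2
        have "((1/k) *\<^sub>R x - y, r/k - Sup L) \<in> G"
          using subspace_scale[OF sG k, of "1/k"] 2 by (simp add: algebra_simps diff_divide_distrib)
        from upper[OF this] have "r / k \<le> norm ((1/k) *\<^sub>R x)" by simp
        then show ?thesis using 2 by (simp add: field_simps)
      next
        case 3
        have "((1/(-k)) *\<^sub>R x + y, r/(-k) + Sup L) \<in> G"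
          using subspace_scale[OF sG k, of "1/(-k)"] 3 by (simp add: algebra_simps diff_divide_distrib)
        from lower[OF this] have "r / (-k) \<le> norm ((1/(-k)) *\<^sub>R x)" by simp
        then show ?thesis using 3 by (simp add: field_simps)
      qed
    qed
    moreover have "G \<subseteq> G'" unfolding G'_def using span_superset by blast
    ultimately have "G' \<in> \<A>" using G0 unfolding \<A>_def G'_def by auto
    from max[OF this \<open>G \<subseteq> G'\<close>] show ?thesis
      unfolding G'_def using span_base[of "(y, Sup L)" "insert (y, Sup L) G"] by auto
  qed
  with sG G0 dom show ?thesis using that by blast
qed

text \<open>The functional with value \<open>0\<close> on \<open>M\<close> and value \<open>d = dist(v, M)\<close> at \<open>v\<close> is dominated
  by the norm, because \<open>k d \<le> norm (m + k v)\<close>.\<close>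

lemma Hahn_Banach_separation:
  fixes M :: "'a::real_normed_vector set"
  assumes "subspace M" "v \<notin> closure M"
  obtains f :: "'a \<Rightarrow> real" where "bounded_linear f" "f v \<noteq> 0" "\<And>x. x \<in> M \<Longrightarrow> f x = 0"
proof -
  define d where "d = infdist v M"
  have ne: "M \<noteq> {}" using subspace_0[OF assms(1)] by blast
  have d: "d > 0"
    unfolding d_def using assms ne in_closure_iff_infdist_zero[of M v] infdist_nonneg[of v M] by simp
  define G0 where "G0 = span (insert (v, d) ((\<lambda>x. (x, 0)) ` M))"
  have sM: "subspace ((\<lambda>x. (x, 0::real)) ` M)"
    by (intro linear_subspace_image assms(1)) (simp add: linear_iff)
  have dom: "r \<le> norm x" if "(x, r) \<in> G0" for x r
  proof -
    from that obtain k where "(x, r) - k *\<^sub>R (v, d) \<in> span ((\<lambda>x. (x, 0)) ` M)"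
      unfolding G0_def span_breakdown_eq by blast
    then have m: "x - k *\<^sub>R v \<in> M" and r: "r = k * d"
      unfolding span_eq_iff[THEN iffD2, OF sM] by auto
    show ?thesis
    proof (cases "k = 0")
      case False
      have "(-1/k) *\<^sub>R (x - k *\<^sub>R v) \<in> M" using assms(1) m by (rule subspace_scale)
      then have "d \<le> dist v ((-1/k) *\<^sub>R (x - k *\<^sub>R v))" unfolding d_def by (rule infdist_le)
      also have "\<dots> = norm ((1/k) *\<^sub>R x)" using False by (simp add: dist_norm algebra_simps)
      finally have "d * \<bar>k\<bar> \<le> norm x" using False by (simp add: field_simps)
      moreover have "k * d \<le> d * \<bar>k\<bar>" using d by (simp add: mult.commute)
      ultimately show ?thesis using r by simp
    qed (simp add: r)
  qed
  obtain G where sG: "subspace G" and G0: "G0 \<subseteq> G"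
    and domG: "\<And>x r. (x, r) \<in> G \<Longrightarrow> r \<le> norm x" and total: "\<And>x. \<exists>r. (x, r) \<in> G"
    using dominated_graph_extends_total[of G0] dom unfolding G0_def by (metis subspace_span)
  have unique: "r = s" if "(x, r) \<in> G" "(x, s) \<in> G" for x r s
    using domG[of 0 "r - s"] domG[of 0 "s - r"] subspace_diff[OF sG that] subspace_diff[OF sG that(2,1)]
    by simp
  define f where "f x = (THE r. (x, r) \<in> G)" for x
  have f: "(x, f x) \<in> G" for x
    unfolding f_def using total unique by (metis theI)
  have f_eq: "f x = r" if "(x, r) \<in> G" for x r using unique[OF f that] .
  have "bounded_linear f"
  proof (rule bounded_linear_intro[where K = 1])
    show "f (x + y) = f x + f y" for x y using subspace_add[OF sG f f, of x y] by (intro f_eq) simp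
    show "f (c *\<^sub>R x) = c *\<^sub>R f x" for c x using subspace_scale[OF sG f, of c x] by (intro f_eq) simp
    show "norm (f x) \<le> norm x * 1" for x
      using domG[OF f, of x] domG[of "-x" "- f x"] subspace_neg[OF sG f, of x] by simp
  qed
  moreover have "f v = d" using G0 span_base[of "(v, d)"] unfolding G0_def by (intro f_eq) blast
  moreover have "f x = 0" if "x \<in> M" for x
    using G0 span_base[of "(x, 0)" "insert (v, d) ((\<lambda>x. (x, 0)) ` M)"] that
    unfolding G0_def by (intro f_eq) blast
  ultimately show ?thesis using that d by simp
qed

lemma hyperplane_kernel:
  fixes f :: "'a::real_normed_vector \<Rightarrow> real"
  assumes "bounded_linear f" "f v \<noteq> 0"
  shows "hyperplane {x. f x = 0}"
proof -
  interpret f: bounded_linear f by fact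
  have "closed {x. f x = 0}" by (intro closed_Collect_eq continuous_intros f.continuous_on)
  moreover have "subspace {x. f x = 0}"
    by (simp add: subspace_def f.zero f.add f.scaleR)
  moreover have "x \<in> span (insert v {x. f x = 0})" for x
    unfolding span_breakdown_eq
    using assms(2) by (intro exI[of _ "f x / f v"] span_base) (simp add: f.diff f.scaleR)
  ultimately show ?thesis unfolding hyperplane_def using assms(2) by blast
qed

text \<open>Lets a hyperplane be replaced by a functional when the task is to show that a set is not
  covered.\<close>

lemma hyperplane_subset_kernel:
  assumes "hyperplane H"
  obtains f :: "'a::real_normed_vector \<Rightarrow> real"
  where "bounded_linear f" "\<exists>v. f v \<noteq> 0" "\<And>x. x \<in> H \<Longrightarrow> f x = 0"
  using assms Hahn_Banach_separation unfolding hyperplane_def by (metis closure_closed)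

lemma countably_hyperplane_covered_kernels:
  fixes f :: "'b \<Rightarrow> 'a::real_normed_vector \<Rightarrow> real"
  assumes "countable B" "\<And>b. b \<in> B \<Longrightarrow> bounded_linear (f b)" "\<And>b. b \<in> B \<Longrightarrow> \<exists>v. f b v \<noteq> 0"
    and "\<And>a. a \<in> A \<Longrightarrow> \<exists>b\<in>B. f b a = 0"
  shows "countably_hyperplane_covered A"
  unfolding countably_hyperplane_covered_def
proof (intro exI[of _ "(\<lambda>b. {x. f b x = 0}) ` B"] conjI ballI)
  show "countable ((\<lambda>b. {x. f b x = 0}) ` B)" using assms(1) by simp
  show "hyperplane H" if "H \<in> (\<lambda>b. {x. f b x = 0}) ` B" for H
    using that assms(2,3) hyperplane_kernel by blast
  show "A \<subseteq> \<Union> ((\<lambda>b. {x. f b x = 0}) ` B)" using assms(4) by blast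
qed

section \<open>Density of closed spans\<close>

text \<open>Only the length of the combinations is tracked, so that cardinalities can be bounded by
  induction; a vector of \<open>S\<close> may be used repeatedly.\<close>

primrec rational_combinations :: "'a::real_vector set \<Rightarrow> nat \<Rightarrow> 'a set" where
  "rational_combinations S 0 = {0}"
| "rational_combinations S (Suc n) =
     (\<lambda>(q, x, y). q *\<^sub>R x + y) ` (\<rat> \<times> S \<times> rational_combinations S n)"

lemma span_subset_closure_rational_combinations:
  fixes S :: "'a::real_normed_vector set"
  shows "span S \<subseteq> closure (\<Union>n. rational_combinations S n)"
proof
  let ?E = "\<Union>n. rational_combinations S n"
  fix z assume "z \<in> span S"
  then show "z \<in> closure ?E"
  proof (induction rule: span_induct_alt)
    case base
    have "0 \<in> rational_combinations S 0" by simp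
    then show ?case by (intro subsetD[OF closure_subset] UN_I[of 0]) auto
  next
    case (step c x y)
    obtain g where g: "\<And>n. g n \<in> ?E" "g \<longlonglongrightarrow> y" using step(2) unfolding closure_sequential by blast
    have "c \<in> closure \<rat>" by (simp add: Rats_closure_real)
    then obtain q where q: "\<And>n::nat. q n \<in> \<rat>" "q \<longlonglongrightarrow> c"
      unfolding closure_sequential by blast
    have "q n *\<^sub>R x + g n \<in> ?E" for n
    proof -
      obtain k where "g n \<in> rational_combinations S k" using g(1) by blast
      then have "q n *\<^sub>R x + g n \<in> rational_combinations S (Suc k)"
        unfolding rational_combinations.simps
        by (intro image_eqI[of _ _ "(q n, x, g n)"]) (use q(1) step(1) in auto)
      then show ?thesis by blast
    qed
    moreover have "(\<lambda>n. q n *\<^sub>R x + g n) \<longlonglongrightarrow> c *\<^sub>R x + y"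
      by (intro tendsto_intros q g)
    ultimately show ?case
      unfolding closure_sequential by (intro exI[of _ "\<lambda>n. q n *\<^sub>R x + g n"] conjI allI)
  qed
qed

lemma card_rational_combinations:
  assumes "infinite S"
  shows "|\<Union>n. rational_combinations S n| \<le>o |S|"
proof -
  have nat: "natLeq \<le>o |S|" using assms infinite_iff_natLeq_ordLeq by blast
  have countable: "|C| \<le>o |S|" if "countable C" for C :: "'c set"
    using that nat ordLeq_transitive unfolding countable_card_le_natLeq by blast
  have "|rational_combinations S n| \<le>o |S|" for n
  proof (induction n)
    case 0
    then show ?case by (simp add: countable)
  next
    case (Suc n)
    have "|(\<rat>::real set) \<times> S \<times> rational_combinations S n| \<le>o |S|"
      by (intro card_of_Sigma_ordLeq_infinite ballI assms Suc countable[OF countable_rat] card_of_mono1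
          subset_refl)
    then show ?case unfolding rational_combinations.simps by (rule ordLeq_transitive[OF card_of_image])
  qed
  then show ?thesis
    using assms by (intro card_of_UNION_ordLeq_infinite) (auto intro: countable)
qed

lemma dens_attained:
  "\<exists>D :: 'a::real_normed_vector set. closure D = UNIV \<and> (\<forall>E :: 'a set. closure E = UNIV \<longrightarrow> |D| \<le>o |E| )
     \<and> dens TYPE('a) = |D|"
  unfolding dens_def by (rule min_card_attained) (use closure_UNIV in blast)

lemma dens_le_dense: "dens TYPE('a) \<le>o |E|" if "closure E = UNIV" for E :: "'a::real_normed_vector set"
  using dens_attained that by metis

text \<open>The rational combinations of \<open>S\<close> are dense, and there are at most \<open>|S|\<close> of them unless
  \<open>S\<close> is finite; a finite \<open>S\<close> would make the space separable.\<close>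

lemma dens_le_spanning_set:
  fixes S :: "'a::real_normed_vector set"
  assumes "closure (span S) = UNIV" "natLeq <o dens TYPE('a)"
  shows "dens TYPE('a) \<le>o |S|"
proof -
  let ?E = "\<Union>n. rational_combinations S n"
  have "closure ?E = UNIV"
    using closure_mono[OF span_subset_closure_rational_combinations[of S]] assms(1) by auto
  then have le: "dens TYPE('a) \<le>o |?E|" by (rule dens_le_dense)
  have "infinite S"
  proof
    assume "finite S"
    then have "countable (rational_combinations S n)" for n
    proof (induction n)
      case (Suc n)
      have "countable ((\<rat> :: real set) \<times> S \<times> rational_combinations S n)"
        using Suc \<open>finite S\<close> by (intro countable_SIGMA countable_rat) (simp_all add: countable_finite)
      then show ?case unfolding rational_combinations.simps by (rule countable_image)
    qed simp
    then have "|?E| \<le>o natLeq" unfolding countable_card_le_natLeq[symmetric] by auto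
    then show False using le assms(2) not_ordLess_ordLeq ordLeq_transitive by blast
  qed
  from card_rational_combinations[OF this] le show ?thesis by (rule ordLeq_transitive[rotated])
qed

section \<open>Cofinal families of countable sets\<close>

text \<open>Stated for sets instead of cardinal orders, so that cofinal families can be moved along
  injections between different types.\<close>

definition cofinal_family :: "'a set \<Rightarrow> 'a set set \<Rightarrow> bool" where
  "cofinal_family S \<F> \<longleftrightarrow>
     (\<forall>C\<in>\<F>. C \<subseteq> S \<and> countable C) \<and> (\<forall>B. B \<subseteq> S \<and> countable B \<longrightarrow> (\<exists>C\<in>\<F>. B \<subseteq> C))"

lemma cofinal_familyD:
  assumes "cofinal_family S \<F>"
  shows "C \<in> \<F> \<Longrightarrow> C \<subseteq> S" "C \<in> \<F> \<Longrightarrow> countable C"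
    "B \<subseteq> S \<Longrightarrow> countable B \<Longrightarrow> \<exists>C\<in>\<F>. B \<subseteq> C"
  using assms unfolding cofinal_family_def by auto

lemma cf_countable_subsets_attained:
  "\<exists>\<F>. cofinal_family (Field \<kappa>) \<F> \<and> (\<forall>\<G>. cofinal_family (Field \<kappa>) \<G> \<longrightarrow> |\<F>| \<le>o |\<G>| )
     \<and> cf_countable_subsets \<kappa> = |\<F>|"
proof -
  have "cofinal_family (Field \<kappa>) {C. C \<subseteq> Field \<kappa> \<and> countable C}"
    unfolding cofinal_family_def by blast
  then have ex: "\<exists>\<F>. cofinal_family (Field \<kappa>) \<F>" by blast
  from min_card_attained[OF this] show ?thesis
    unfolding cf_countable_subsets_def cofinal_family_def .
qed

lemma cf_countable_subsets_le: "cf_countable_subsets \<kappa> \<le>o |\<F>|" if "cofinal_family (Field \<kappa>) \<F>"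
  using cf_countable_subsets_attained that by metis

text \<open>Preimages under an injection of \<open>T\<close> into \<open>S\<close> keep countability and cofinality, so the
  cofinality of the countable subsets is monotone in the cardinal.\<close>

lemma cofinal_family_transfer:
  assumes "cofinal_family S \<F>" "|T| \<le>o |S|"
  obtains \<G> where "cofinal_family T \<G>" "|\<G>| \<le>o |\<F>|"
proof -
  obtain g where g: "inj_on g T" "g ` T \<subseteq> S" using assms(2) card_of_ordLeq[of T S] by blast
  have "countable {t\<in>T. g t \<in> C}" if "C \<in> \<F>" for C
  proof (rule countable_image_inj_on[of g])
    show "countable (g ` {t\<in>T. g t \<in> C})"
      by (rule countable_subset[OF _ cofinal_familyD(2)[OF assms(1) that]]) blast
    show "inj_on g {t\<in>T. g t \<in> C}" by (rule inj_on_subset[OF g(1)]) blast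
  qed
  moreover have "\<exists>C\<in>\<F>. B \<subseteq> {t\<in>T. g t \<in> C}" if B: "B \<subseteq> T" "countable B" for B
  proof -
    have "g ` B \<subseteq> S" "countable (g ` B)" using B g(2) by auto
    from cofinal_familyD(3)[OF assms(1) this] show ?thesis using B by blast
  qed
  ultimately have "cofinal_family T ((\<lambda>C. {t\<in>T. g t \<in> C}) ` \<F>)"
    unfolding cofinal_family_def by auto
  then show ?thesis using that card_of_image by blast
qed

lemma is_omega_infinite_cardinal: "is_omega n (r :: 'a rel) \<Longrightarrow> Card_order r \<and> natLeq \<le>o r"
proof (induction n arbitrary: r)
  case 0
  then have r: "r =o natLeq" by simp
  show ?case
    using Card_order_ordIso[OF natLeq_Card_order r] ordIso_iff_ordLeq[of natLeq r] ordIso_symmetric[OF r]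
    by blast
next
  case (Suc n)
  then obtain s :: "'a rel" where s: "Card_order s" "natLeq \<le>o s" and r: "r =o cardSuc s"
    unfolding is_omega.simps by blast
  have "natLeq \<le>o cardSuc s" by (rule ordLeq_transitive[OF s(2) cardSuc_ordLeq[OF s(1)]])
  then show ?case
    using Card_order_ordIso[OF cardSuc_Card_order[OF s(1)] r] ordLeq_ordIso_trans[OF _ ordIso_symmetric[OF r]]
    by simp
qed

text \<open>In the successor step each proper initial segment of \<open>k = \<omega>\<^bsub>n+1\<^esub>\<close> has size at most
  \<open>\<omega>\<^sub>n\<close> and inherits a small cofinal family. Every countable subset of \<open>k\<close> is bounded
  because \<open>k\<close> is regular, so the union of these families over all segments is cofinal in
  \<open>k\<close>, and it has at most \<open>k\<close> members.\<close>

lemma cofinal_family_omega: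
  fixes r :: "'a rel"
  assumes "is_omega n r"
  shows "\<exists>\<F>. cofinal_family (Field r) \<F> \<and> |\<F>| \<le>o r"
  using assms
proof (induction n arbitrary: r)
  case 0
  have r: "Card_order r" "natLeq \<le>o r" using is_omega_infinite_cardinal[OF 0] by auto
  have "|Field r| \<le>o natLeq"
    using card_of_Field_ordIso[OF r(1)] 0 by (auto intro: ordIso_transitive ordIso_imp_ordLeq)
  then have "countable (Field r)" by (simp add: countable_card_le_natLeq)
  then have "cofinal_family (Field r) {Field r}" unfolding cofinal_family_def by blast
  moreover have "|{Field r}| \<le>o natLeq" by (simp add: countable_card_le_natLeq[symmetric])
  ultimately show ?case using r(2) ordLeq_transitive by blast
next
  case (Suc n)
  then obtain s :: "'a rel" where om: "is_omega n s" and r: "r =o cardSuc s" by auto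
  obtain \<F> where F: "cofinal_family (Field s) \<F>" "|\<F>| \<le>o s" using Suc.IH[OF om] by blast
  have s: "Card_order s" "natLeq \<le>o s" using is_omega_infinite_cardinal[OF om] by auto
  have cr: "Card_order r" using is_omega_infinite_cardinal[OF Suc.prems] by auto
  define k where "k = cardSuc s"
  have k: "Card_order k" unfolding k_def by (rule cardSuc_Card_order[OF s(1)])
  have sk: "s \<le>o k" unfolding k_def by (rule cardSuc_ordLeq[OF s(1)])
  have infs: "infinite (Field s)"
    using ordLeq_ordIso_trans[OF s(2) ordIso_symmetric[OF card_of_Field_ordIso[OF s(1)]]]
      infinite_iff_natLeq_ordLeq[of "Field s"] by blast
  then have infk: "infinite (Field k)" unfolding k_def using cardSuc_finite[OF s(1)] by simp
  have "\<exists>\<G>. cofinal_family (underS k a) \<G> \<and> |\<G>| \<le>o k" if "a \<in> Field k" for a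
  proof -
    have "|underS k a| <o cardSuc s" using card_of_underS[OF k that] unfolding k_def .
    then have "|underS k a| \<le>o s" using cardSuc_ordLeq_ordLess[OF s(1) card_of_Card_order] by blast
    then have "|underS k a| \<le>o |Field s|"
      by (rule ordLeq_ordIso_trans[OF _ ordIso_symmetric[OF card_of_Field_ordIso[OF s(1)]]])
    then obtain \<G> where "cofinal_family (underS k a) \<G>" "|\<G>| \<le>o |\<F>|"
      using cofinal_family_transfer[OF F(1)] by blast
    then show ?thesis using ordLeq_transitive[OF _ ordLeq_transitive[OF F(2) sk]] by blast
  qed
  then obtain \<G> where G: "\<And>a. a \<in> Field k \<Longrightarrow> cofinal_family (underS k a) (\<G> a)"
    "\<And>a. a \<in> Field k \<Longrightarrow> |\<G> a| \<le>o k" by metis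
  define \<U> where "\<U> = (\<Union>a\<in>Field k. \<G> a)"
  have "\<exists>C\<in>\<U>. B \<subseteq> C" if B: "B \<subseteq> Field k" "countable B" for B
  proof -
    have "relChain k (underS k)"
    proof -
      have "trans k" "antisym k"
        using k unfolding card_order_on_def well_order_on_def linear_order_on_def
          partial_order_on_def preorder_on_def by auto
      then show ?thesis unfolding relChain_def underS_def by (blast dest: transD antisymD)
    qed
    moreover have "B \<subseteq> (\<Union>a\<in>Field k. underS k a)"
      using B(1) infinite_Card_order_limit[OF k infk] unfolding underS_def by blast
    moreover have "|B| \<le>o s"
      using B(2) unfolding countable_card_le_natLeq by (rule ordLeq_transitive[OF _ s(2)])
    ultimately obtain a where a: "a \<in> Field k" "B \<subseteq> underS k a"
      using cardSuc_UNION[OF s(1) infs, of "underS k" B] unfolding k_def by blast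
    from cofinal_familyD(3)[OF G(1)[OF a(1)] a(2) B(2)] show ?thesis
      unfolding \<U>_def using a(1) by blast
  qed
  moreover have "C \<subseteq> Field k \<and> countable C" if "C \<in> \<U>" for C
  proof -
    obtain a where "a \<in> Field k" "C \<in> \<G> a" using \<open>C \<in> \<U>\<close> unfolding \<U>_def by blast
    moreover have "underS k a \<subseteq> Field k" by (auto simp: underS_def Field_def)
    ultimately show ?thesis using cofinal_familyD(1,2)[OF G(1)] by blast
  qed
  ultimately have U: "cofinal_family (Field k) \<U>" unfolding cofinal_family_def by blast
  have "|Field k| \<le>o k" using card_of_Field_ordIso[OF k] ordIso_imp_ordLeq by blast
  then have "|\<U>| \<le>o k"
    unfolding \<U>_def using G(2) by (intro card_of_UNION_ordLeq_infinite_Field[OF infk k]) auto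
  moreover have "|Field r| \<le>o |Field k|"
  proof -
    have "|Field r| =o |Field k|"
      using card_of_Field_ordIso[OF cr] r card_of_Field_ordIso[OF k] unfolding k_def
      by (meson ordIso_symmetric ordIso_transitive)
    then show ?thesis by (rule ordIso_imp_ordLeq)
  qed
  then obtain \<F>' where "cofinal_family (Field r) \<F>'" "|\<F>'| \<le>o |\<U>|"
    using cofinal_family_transfer[OF U] by blast
  moreover have "k =o r" unfolding k_def using r by (rule ordIso_symmetric)
  ultimately show ?case
    using ordLeq_ordIso_trans[OF ordLeq_transitive] by blast
qed

section \<open>Small sets that no countable family of hyperplanes covers\<close>

text \<open>The series extends to a holomorphic function on the complex unit disc. Its zeros are isolated
  unless it is constant, and the nonzero coefficient leaves only nonzero constants.\<close>

lemma countable_zeros_power_series: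
  fixes a :: "nat \<Rightarrow> real"
  assumes bound: "\<And>n. \<bar>a n\<bar> \<le> K" and "a m \<noteq> 0"
  shows "countable {t. \<bar>t\<bar> < 1 \<and> (\<lambda>n. a n * t ^ n) sums 0}"
proof -
  define h where "h z = (\<Sum>n. complex_of_real (a n) * z ^ n)" for z
  have sums: "(\<lambda>n. complex_of_real (a n) * z ^ n) sums h z" if "norm z < 1" for z
  proof -
    have "summable (\<lambda>n. complex_of_real (a n) * z ^ n)"
    proof (rule summable_comparison_test')
      show "summable (\<lambda>n. K * norm z ^ n)" using that by (intro summable_mult summable_geometric) simp
      show "norm (complex_of_real (a n) * z ^ n) \<le> K * norm z ^ n" for n
        using bound[of n] by (simp add: norm_mult norm_power mult_right_mono)
    qed
    then show ?thesis unfolding h_def by (rule summable_sums)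
  qed
  have "countable {z\<in>ball 0 1. h z = 0}"
  proof (cases "h constant_on ball 0 1")
    case False
    have "h holomorphic_on ball 0 1"
      using sums by (intro power_series_holomorphic[where a = "\<lambda>n. complex_of_real (a n)"]) simp
    moreover have "fsigma (ball (0::complex) 1)"
      using open_Union_compact_subsets[OF open_ball, of "0::complex" 1] fsigma.intros compact_imp_closed
      by metis
    ultimately show ?thesis using False by (intro holomorphic_countable_zeros) auto
  next
    case True
    then have const: "h z = h 0" if "norm z < 1" for z
      using that unfolding constant_on_def by force
    have h0: "h 0 = a 0" using powser_sums_zero_iff[of "\<lambda>n. complex_of_real (a n)" "h 0"] sums[of 0] by simp
    have "a 0 \<noteq> 0"
    proof
      assume "a 0 = 0"
      then have "m > 0" and "h 0 = 0" using \<open>a m \<noteq> 0\<close> h0 by (auto intro: gr0I)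
      obtain s where s: "0 < s" "\<And>z. z \<in> cball 0 s - {0} \<Longrightarrow> h z \<noteq> 0"
        using powser_0_nonzero[of 1 0 "\<lambda>n. complex_of_real (a n)" h m] sums \<open>h 0 = 0\<close> \<open>a m \<noteq> 0\<close> \<open>m > 0\<close>
        by auto
      define z where "z = complex_of_real (min s (1/2))"
      have "norm z = min s (1/2)" using s(1) unfolding z_def by simp
      then have "norm z < 1" "norm z \<le> s" "z \<noteq> 0" using s(1) by (auto simp flip: zero_less_norm_iff)
      then have "h z \<noteq> 0" using s(2) by simp
      with const[of z] \<open>h 0 = 0\<close> \<open>norm z < 1\<close> show False by simp
    qed
    then have "{z\<in>ball 0 1. h z = 0} = {}" using const h0 by auto
    then show ?thesis by (metis countable_empty)
  qed
  moreover have "complex_of_real ` {t. \<bar>t\<bar> < 1 \<and> (\<lambda>n. a n * t ^ n) sums 0} \<subseteq> {z\<in>ball 0 1. h z = 0}"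
  proof safe
    fix t :: real assume t: "\<bar>t\<bar> < 1" "(\<lambda>n. a n * t ^ n) sums 0"
    then show "complex_of_real t \<in> ball 0 1" by simp
    have "(\<lambda>n. complex_of_real (a n) * complex_of_real t ^ n) sums 0"
      using sums_of_real[OF t(2), where 'a = complex] by simp
    then show "h (complex_of_real t) = 0" using sums[of "complex_of_real t"] t(1) sums_unique2 by force
  qed
  ultimately have "countable (complex_of_real ` {t. \<bar>t\<bar> < 1 \<and> (\<lambda>n. a n * t ^ n) sums 0})"
    by (rule countable_subset[rotated])
  then show ?thesis by (rule countable_image_inj_on) (simp add: inj_on_def)
qed

text \<open>Normalizing the coefficients by \<open>sgn\<close> makes the series converge for every sequence
  \<open>c\<close> without changing which functionals vanish at the \<open>c n\<close>.\<close>

definition analytic_curve :: "(nat \<Rightarrow> 'a::banach) \<Rightarrow> real \<Rightarrow> 'a" where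
  "analytic_curve c t = (\<Sum>n. t ^ n *\<^sub>R sgn (c n))"

lemma analytic_curve_sums:
  assumes "\<bar>t\<bar> < 1"
  shows "(\<lambda>n. t ^ n *\<^sub>R sgn (c n)) sums analytic_curve c t"
  unfolding analytic_curve_def
proof (rule summable_sums[OF summable_comparison_test'])
  show "summable (\<lambda>n. \<bar>t\<bar> ^ n)" using assms by (intro summable_geometric) simp
  show "norm (t ^ n *\<^sub>R sgn (c n)) \<le> \<bar>t\<bar> ^ n" for n by (simp add: norm_sgn power_abs)
qed

lemma countable_analytic_curve_Int_kernel:
  fixes f :: "'a::banach \<Rightarrow> real"
  assumes "bounded_linear f" "f (c m) \<noteq> 0"
  shows "countable {t. \<bar>t\<bar> < 1 \<and> f (analytic_curve c t) = 0}"
proof -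
  interpret f: bounded_linear f by fact
  obtain K where K: "\<And>x. norm (f x) \<le> norm x * K" and "K \<ge> 0" using f.nonneg_bounded by blast
  have "(\<lambda>n. f (sgn (c n)) * t ^ n) sums f (analytic_curve c t)" if "\<bar>t\<bar> < 1" for t
    using f.sums[OF analytic_curve_sums[OF that, of c]] by (simp add: f.scaleR mult.commute)
  then have "{t. \<bar>t\<bar> < 1 \<and> f (analytic_curve c t) = 0} \<subseteq>
      {t. \<bar>t\<bar> < 1 \<and> (\<lambda>n. f (sgn (c n)) * t ^ n) sums 0}" by force
  moreover have "countable \<dots>"
  proof (rule countable_zeros_power_series)
    show "\<bar>f (sgn (c n))\<bar> \<le> K" for n
      using K[of "sgn (c n)"] \<open>K \<ge> 0\<close> by (auto simp: norm_sgn split: if_splits)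
    have "c m \<noteq> 0" using assms(2) f.zero by metis
    then show "f (sgn (c m)) \<noteq> 0" using assms(2) by (simp add: sgn_div_norm f.scaleR)
  qed
  ultimately show ?thesis by (rule countable_subset)
qed

text \<open>Provides curve parameters: uncountably many, yet few enough that choosing them for every
  member of a cofinal family \<open>F\<close> does not exceed the cardinality of \<open>F\<close>.\<close>

lemma uncountable_real_subset_card_le:
  assumes "uncountable F"
  obtains T :: "real set" where "T \<subseteq> {0<..<1}" "uncountable T" "|T| \<le>o |F|"
proof (cases "|{0<..<1::real}| \<le>o |F|")
  case True
  then show ?thesis by (intro that[of "{0<..<1}"]) (auto simp: uncountable_open_interval)
next
  case False
  then have "|F| \<le>o |{0<..<1::real}|" using ordLeq_total[OF card_of_Well_order card_of_Well_order] by blast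
  then obtain g where g: "inj_on g F" "g ` F \<subseteq> {0<..<1::real}"
    using card_of_ordLeq[of F "{0<..<1::real}"] by blast
  have "uncountable (g ` F)" using assms g(1) countable_image_inj_on by blast
  then show ?thesis by (rule that[OF g(2) _ card_of_image])
qed

lemma bounded_linear_vanishes_on_dense:
  fixes f :: "'a::real_normed_vector \<Rightarrow> real"
  assumes "bounded_linear f" "closure D = UNIV" "\<And>d. d \<in> D \<Longrightarrow> f d = 0"
  shows "f x = 0"
proof -
  have "closed {x. f x = 0}"
    by (intro closed_Collect_eq continuous_intros linear_continuous_on assms(1))
  then have "closure D \<subseteq> {x. f x = 0}" using assms(3) by (intro closure_minimal) auto
  then show ?thesis using assms(2) by blast
qed

text \<open>A cofinal family on an uncountable set is itself uncountable, so uncountably many parameters can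
  be used without making the set larger than the family.\<close>

lemma exists_uncovered_set_of_card_cf:
  assumes "natLeq <o dens TYPE('a::banach)"
  obtains A :: "'a::banach set" where "\<not> countably_hyperplane_covered A"
    "|A| \<le>o cf_countable_subsets (dens TYPE('a::banach))"
proof -
  obtain D :: "'a set" where D: "closure D = UNIV" "dens TYPE('a) = |D|"
    using dens_attained by metis
  obtain \<F> where F: "cofinal_family (Field (dens TYPE('a))) \<F>"
    and cf: "cf_countable_subsets (dens TYPE('a)) = |\<F>|"
    using cf_countable_subsets_attained by metis
  have FD: "cofinal_family D \<F>" using F D(2) by (simp add: Field_card_of)
  have "uncountable D"
    using assms not_ordLess_ordLeq unfolding D(2) countable_card_le_natLeq by blast
  have "uncountable \<F>"
  proof
    assume "countable \<F>"
    then have "countable (\<Union>\<F>)"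
      using countable_UN[of \<F> "\<lambda>C. C"] cofinal_familyD(2)[OF FD] by simp
    moreover have "D \<subseteq> \<Union>\<F>"
    proof
      fix d assume "d \<in> D"
      then show "d \<in> \<Union>\<F>" using cofinal_familyD(3)[OF FD, of "{d}"] by auto
    qed
    ultimately show False using \<open>uncountable D\<close> countable_subset by blast
  qed
  then have infF: "infinite \<F>" using countable_finite by blast
  obtain T :: "real set" where T: "T \<subseteq> {0<..<1}" "uncountable T" "|T| \<le>o |\<F>|"
    using uncountable_real_subset_card_le[OF \<open>uncountable \<F>\<close>] by blast
  define A where "A = (\<lambda>(C, t). analytic_curve (from_nat_into C) t) ` (\<F> \<times> T)"
  have "|\<F> \<times> T| \<le>o |\<F>|"
    by (intro card_of_Sigma_ordLeq_infinite ballI infF T(3) card_of_mono1 subset_refl)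
  then have "|A| \<le>o |\<F>|" unfolding A_def by (rule ordLeq_transitive[OF card_of_image])
  moreover have "\<not> countably_hyperplane_covered A"
  proof
    assume "countably_hyperplane_covered A"
    then obtain \<H> where H: "countable \<H>" "\<And>H. H \<in> \<H> \<Longrightarrow> hyperplane H" "A \<subseteq> \<Union>\<H>"
      unfolding countably_hyperplane_covered_def by blast
    have "\<exists>f :: 'a \<Rightarrow> real. bounded_linear f \<and> (\<forall>x\<in>H. f x = 0) \<and> (\<exists>d\<in>D. f d \<noteq> 0)"
      if H_in: "H \<in> \<H>" for H
    proof -
      obtain f :: "'a \<Rightarrow> real" where f: "bounded_linear f" "\<exists>v. f v \<noteq> 0" "\<And>x. x \<in> H \<Longrightarrow> f x = 0"
        using hyperplane_subset_kernel[OF H(2)[OF H_in]] by blast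
      then show ?thesis using bounded_linear_vanishes_on_dense[OF f(1) D(1)] by blast
    qed
    then obtain f :: "'a set \<Rightarrow> 'a \<Rightarrow> real" and d
      where f: "\<And>H. H \<in> \<H> \<Longrightarrow> bounded_linear (f H)" "\<And>H x. H \<in> \<H> \<Longrightarrow> x \<in> H \<Longrightarrow> f H x = 0"
        and d: "\<And>H. H \<in> \<H> \<Longrightarrow> d H \<in> D" "\<And>H. H \<in> \<H> \<Longrightarrow> f H (d H) \<noteq> 0"
      by metis
    \<comment> \<open>Cofinality yields one member \<open>C\<close> that escapes all the hyperplanes simultaneously.\<close>
    have "d ` \<H> \<subseteq> D" "countable (d ` \<H>)" using d(1) H(1) by auto
    from cofinal_familyD(3)[OF FD this] obtain C where C: "C \<in> \<F>" "d ` \<H> \<subseteq> C" by blast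
    let ?c = "from_nat_into C"
    have "countable {t. \<bar>t\<bar> < 1 \<and> f H (analytic_curve ?c t) = 0}" if "H \<in> \<H>" for H
    proof -
      have "d H \<in> C" using C(2) that by blast
      then obtain m where "?c m = d H"
        using from_nat_into_surj[OF cofinal_familyD(2)[OF FD C(1)]] by blast
      with d(2)[OF that] show ?thesis
        by (intro countable_analytic_curve_Int_kernel[OF f(1)[OF that], of _ m]) simp
    qed
    then have "countable (\<Union>H\<in>\<H>. {t. \<bar>t\<bar> < 1 \<and> f H (analytic_curve ?c t) = 0})"
      using H(1) by simp
    moreover have "T \<subseteq> (\<Union>H\<in>\<H>. {t. \<bar>t\<bar> < 1 \<and> f H (analytic_curve ?c t) = 0})"
    proof
      fix t assume t: "t \<in> T"
      then have "analytic_curve ?c t \<in> A" unfolding A_def using C(1) by force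
      then obtain H where "H \<in> \<H>" "analytic_curve ?c t \<in> H" using H(3) by blast
      moreover have "\<bar>t\<bar> < 1" using t T(1) by force
      ultimately show "t \<in> (\<Union>H\<in>\<H>. {t. \<bar>t\<bar> < 1 \<and> f H (analytic_curve ?c t) = 0})"
        using f(2) by blast
    qed
    ultimately show False using T(2) countable_subset by blast
  qed
  ultimately show ?thesis using that cf by simp
qed

section \<open>Covering small sets\<close>

text \<open>Finite combinations of the \<open>x i\<close> have finite support, and the support of the limit of a
  sequence is contained in the union of the supports of its terms.\<close>

lemma countable_support_biorthogonal:
  assumes "fundamental_biorthogonal_system I x f"
  shows "countable {i\<in>I. blinfun_apply (f i) a \<noteq> 0}"
proof -
  have bio: "biorthogonal_system I x f" and "a \<in> closure (span (x ` I))"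
    using assms unfolding fundamental_biorthogonal_system_def by auto
  then obtain g where g: "\<And>n. g n \<in> span (x ` I)" "g \<longlonglongrightarrow> a"
    unfolding closure_sequential by blast
  have "finite {i\<in>I. f i y \<noteq> 0}" if "y \<in> span (x ` I)" for y
    using that
  proof (induction rule: span_induct_alt)
    case (step c z y)
    then obtain j where j: "j \<in> I" "z = x j" by blast
    have "{i\<in>I. f i (c *\<^sub>R z + y) \<noteq> 0} \<subseteq> insert j {i\<in>I. f i y \<noteq> 0}"
      using bio j unfolding biorthogonal_system_def
      by (auto simp: blinfun.add_right blinfun.scaleR_right)
    then show ?case using step(2) finite_subset by blast
  qed simp
  then have "countable (\<Union>n. {i\<in>I. f i (g n) \<noteq> 0})" using g(1) by (auto intro: countable_finite)
  moreover have "{i\<in>I. f i a \<noteq> 0} \<subseteq> (\<Union>n. {i\<in>I. f i (g n) \<noteq> 0})"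
  proof (rule ccontr)
    assume "\<not> ?thesis"
    then obtain i where i: "f i a \<noteq> 0" "\<And>n. f i (g n) = 0" by blast
    have "(\<lambda>n. f i (g n)) \<longlonglongrightarrow> f i a" by (intro tendsto_intros g)
    then show False using i by (simp add: LIMSEQ_const_iff)
  qed
  ultimately show ?thesis by (rule countable_subset[rotated])
qed

text \<open>There are at least as many indices as the density, since the vectors \<open>x i\<close> span a dense
  subspace. Transported to a dense set \<open>D\<close> of minimal size by an injection \<open>g\<close> of \<open>D\<close> into
  the index set, the supports of the vectors in \<open>A\<close> form too small a family to be cofinal; a
  countable set \<open>B\<close> that witnesses this selects the functionals whose kernels cover \<open>A\<close>.\<close>

lemma covered_if_fundamental_biorthogonal_system:
  fixes x :: "'i \<Rightarrow> 'a::real_normed_vector" and A :: "'a set"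
  assumes sys: "fundamental_biorthogonal_system I x f" and "natLeq <o dens TYPE('a)"
    and small: "|A| <o cf_countable_subsets (dens TYPE('a))"
  shows "countably_hyperplane_covered A"
proof -
  obtain D :: "'a set" where D: "dens TYPE('a) = |D|" using dens_attained by metis
  have "closure (span (x ` I)) = UNIV" using sys unfolding fundamental_biorthogonal_system_def by blast
  from dens_le_spanning_set[OF this assms(2)] have "|D| \<le>o |I|"
    unfolding D by (rule ordLeq_transitive[OF _ card_of_image])
  then obtain g where g: "inj_on g D" "g ` D \<subseteq> I" using card_of_ordLeq[of D I] by blast
  let ?supp = "\<lambda>a. {d\<in>D. f (g d) a \<noteq> 0}"
  have supp: "countable (?supp a)" for a
  proof (rule countable_image_inj_on[of g])
    show "countable (g ` ?supp a)"
      by (rule countable_subset[OF _ countable_support_biorthogonal[OF sys, of a]]) (use g(2) in blast)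
    show "inj_on g (?supp a)" by (rule inj_on_subset[OF g(1)]) blast
  qed
  define \<F> where "\<F> = ?supp ` A"
  have "\<not> cofinal_family D \<F>"
  proof
    assume "cofinal_family D \<F>"
    then have "cf_countable_subsets (dens TYPE('a)) \<le>o |\<F>|"
      using cf_countable_subsets_le[of "dens TYPE('a)"] unfolding D by (simp add: Field_card_of)
    then have "cf_countable_subsets (dens TYPE('a)) \<le>o |A|"
      unfolding \<F>_def by (rule ordLeq_transitive[OF _ card_of_image])
    then show False using small not_ordLess_ordLeq by blast
  qed
  moreover have "\<forall>C\<in>\<F>. C \<subseteq> D \<and> countable C" unfolding \<F>_def using supp by auto
  ultimately obtain B where B: "B \<subseteq> D" "countable B" "\<And>C. C \<in> \<F> \<Longrightarrow> \<not> B \<subseteq> C"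
    unfolding cofinal_family_def by metis
  show ?thesis
  proof (rule countably_hyperplane_covered_kernels[OF B(2)])
    show "bounded_linear (f (g b))" for b by (rule blinfun.bounded_linear_right)
    show "\<exists>v. f (g b) v \<noteq> 0" if "b \<in> B" for b
    proof
      have "g b \<in> I" using that B(1) g(2) by blast
      then show "f (g b) (x (g b)) \<noteq> 0"
        using sys unfolding fundamental_biorthogonal_system_def biorthogonal_system_def by simp
    qed
    show "\<exists>b\<in>B. f (g b) a = 0" if "a \<in> A" for a
    proof -
      have "\<not> B \<subseteq> ?supp a" using B(3) that unfolding \<F>_def by simp
      then show ?thesis using B(1) by blast
    qed
  qed
qed

lemma covered_if_card_less_dens:
  fixes A :: "'a::real_normed_vector set"
  assumes "natLeq <o dens TYPE('a)" "|A| <o dens TYPE('a)"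
  shows "countably_hyperplane_covered A"
proof -
  have "closure (span A) \<noteq> UNIV" using dens_le_spanning_set[of A] assms not_ordLess_ordLeq by blast
  then obtain v where "v \<notin> closure (span A)" by blast
  then obtain f :: "'a \<Rightarrow> real" where f: "bounded_linear f" "f v \<noteq> 0" "\<And>x. x \<in> span A \<Longrightarrow> f x = 0"
    using Hahn_Banach_separation[OF subspace_span] by blast
  then show ?thesis
    using span_base[of _ A]
    by (intro countably_hyperplane_covered_kernels[of "{()}" "\<lambda>_. f"]) auto
qed

lemma covered_if_dens_countable:
  fixes A :: "'a::real_normed_vector set"
  assumes "dens TYPE('a) \<le>o natLeq" "|A| <o cf_countable_subsets (dens TYPE('a))"
  shows "countably_hyperplane_covered A"
proof -
  obtain D :: "'a set" where D: "dens TYPE('a) = |D|" using dens_attained by metis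
  have "countable D" using assms(1) unfolding D countable_card_le_natLeq .
  then have "cofinal_family D {D}" unfolding cofinal_family_def by blast
  then have "cf_countable_subsets (dens TYPE('a)) \<le>o |{D}|"
    using cf_countable_subsets_le[of "dens TYPE('a)" "{D}"] unfolding D by (simp add: Field_card_of)
  then have "|A| <o |{D}|" using assms(2) ordLess_ordLeq_trans by blast
  then have "A = {}" using card_of_singl_ordLeq[of A D] not_ordLess_ordLeq by blast
  then show ?thesis unfolding countably_hyperplane_covered_def by (intro exI[of _ "{}"]) simp
qed

theorem theorem7:
  fixes X :: "'a::banach itself"
  assumes dim_gt_1: "\<exists>B :: 'a set. independent B \<and> span B = UNIV \<and> (infinite B \<or> 1 < card B)"
    and X_class:
      "(\<exists>(I :: 'i set) (x :: 'i \<Rightarrow> 'a) f. fundamental_biorthogonal_system I x f) \<or>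
       (\<exists>n. is_omega n (dens X))"
  shows "(\<forall>A :: 'a set. |A| <o cf_countable_subsets (dens X) \<longrightarrow> countably_hyperplane_covered A) \<and>
         (natLeq <o dens X \<longrightarrow> non X =o cf_countable_subsets (dens X))"
proof -
  have X: "dens X = dens TYPE('a)" unfolding dens_def ..
  have wo: "Well_order (dens X)"
    using dens_attained[where 'a = 'a] card_of_Well_order unfolding X by metis
  have small_covered: "countably_hyperplane_covered A" if A: "|A| <o cf_countable_subsets (dens X)"
    for A :: "'a set"
  proof (cases "natLeq <o dens X")
    case False
    then have "dens X \<le>o natLeq" using wo natLeq_Well_order not_ordLess_iff_ordLeq by blast
    then show ?thesis using covered_if_dens_countable A unfolding X by blast
  next
    case unc: True
    from X_class show ?thesis
    proof (elim disjE exE)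
      fix I x f assume "fundamental_biorthogonal_system (I :: 'i set) (x :: 'i \<Rightarrow> 'a) f"
      then show ?thesis
        by (rule covered_if_fundamental_biorthogonal_system[OF _ unc[unfolded X] A[unfolded X]])
    next
      fix n assume "is_omega n (dens X)"
      from cofinal_family_omega[OF this] obtain \<F> where
        "cofinal_family (Field (dens X)) \<F>" "|\<F>| \<le>o dens X" by blast
      then have "cf_countable_subsets (dens X) \<le>o dens X"
        using ordLeq_transitive[OF cf_countable_subsets_le] by blast
      then have "|A| <o dens X" using A ordLess_ordLeq_trans by blast
      then show ?thesis using covered_if_card_less_dens unc unfolding X by blast
    qed
  qed
  moreover have "non X =o cf_countable_subsets (dens X)" if unc: "natLeq <o dens X"
  proof -
    obtain A :: "'a set" where A: "\<not> countably_hyperplane_covered A"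
      "|A| \<le>o cf_countable_subsets (dens X)"
      using exists_uncovered_set_of_card_cf[where 'a = 'a] unc unfolding X by blast
    then have "\<exists>A :: 'a set. \<not> countably_hyperplane_covered A" by blast
    from min_card_attained[OF this] obtain A0 :: "'a set" where
      A0: "\<not> countably_hyperplane_covered A0" "|A0| \<le>o |A|" "non X = |A0|"
      unfolding non_def using A(1) by blast
    obtain \<F> where cf: "cf_countable_subsets (dens X) = |\<F>|"
      using cf_countable_subsets_attained by metis
    have "non X \<le>o cf_countable_subsets (dens X)" unfolding A0(3) by (rule ordLeq_transitive[OF A0(2) A(2)])
    moreover have "cf_countable_subsets (dens X) \<le>o non X"
      using small_covered[of A0] A0(1) unfolding A0(3) cf
      using not_ordLess_iff_ordLeq[OF card_of_Well_order card_of_Well_order] by blast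
    ultimately show ?thesis using ordIso_iff_ordLeq by blast
  qed
  ultimately show ?thesis by blast
qed

end
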